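(* Let $\epsilon>0$ be any small constant. Then: (1) Any randomized one-pass streaming algorithm for random-order \textsf{Unit Interval Selection} with expected approximation factor $8/9+\epsilon$ must use $\Omega(n)$ bits of space. (2) For any $\delta>0$, any randomized one-pass streaming algorithm for random-order \textsf{Unit Interval Selection} with approximation factor $2/3+\delta$ that succeeds with probability at least $2/3+\epsilon$ on any input instance must use $\Omega(n)$ bits of space. The expectation in (1) and the probability in (2) are taken over both the stream order and the random choices of the algorithm.
   Context: \textsf{Unit Interval Selection}: the input is a set of $n$ closed intervals $[a,a+1]$ of length $1$ on the real line; an independent set is a set of pairwise disjoint intervals, and the goal is to output an independent subset of maximum cardinality $|OPT|$. In random-order streaming, the $n$ input intervals are presented one at a time in a uniformly random order, and the algorithm makes one pass. An algorithm has (expected) approximation factor $\beta$ if it outputs an independent set $\mathcal{J}$ with $|\mathcal{J}|\ge\beta|OPT|$ (respectively $\mathbb{E}|\mathcal{J}|\ge\beta|OPT|$) on every input. In (2), "succeeds" means that the output is an independent set of size at least $(2/3+\delta)|OPT|$. *)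

theory Defs
  imports
    "HOL-Probability.Probability"
    "HOL-Combinatorics.Multiset_Permutations"
    "HOL-Library.Landau_Symbols"
    "HOL-Library.Disjoint_Sets"
begin

text \<open>A unit interval is represented by its left endpoint throughout, so problem instances and
  outputs are sets of reals.\<close>

definition unit_interval :: "real \<Rightarrow> real set" where
  "unit_interval a = {a..a + 1}"

definition independent_intervals :: "real set \<Rightarrow> bool" where
  "independent_intervals J \<longleftrightarrow> disjoint_family_on unit_interval J"

definition opt :: "real set \<Rightarrow> nat" where
  "opt I = Max (card ` {J. J \<subseteq> I \<and> independent_intervals J})"

text \<open>\<open>U\<close> is the set of left endpoints that may occur. It is a parameter because space is counted
  in bits: an algorithm with finite memory can only name finitely many intervals in its output, so
  over \<open>U = UNIV\<close> no finite amount of space suffices at all.\<close>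

definition inputs :: "real set \<Rightarrow> nat \<Rightarrow> real set set" where
  "inputs U n = {I. I \<subseteq> U \<and> finite I \<and> card I = n}"

definition grid :: "nat \<Rightarrow> real set" where
  "grid m = {real k / real m | k. k \<le> 4 * m}"

text \<open>A deterministic one-pass algorithm whose memory content is a bit string. The update may depend
  on the number of intervals read so far at no cost in space; the output is computed from the
  final memory content alone.\<close>

record stream_alg =
  init_mem :: "bool list"
  update :: "nat \<Rightarrow> real \<Rightarrow> bool list \<Rightarrow> bool list"
  result :: "bool list \<Rightarrow> real set"

definition memory_after :: "stream_alg \<Rightarrow> real list \<Rightarrow> bool list" where
  "memory_after D xs = foldl (\<lambda>q (t, x). update D t x q) (init_mem D) (List.enumerate 0 xs)"

definition alg_output :: "stream_alg \<Rightarrow> real list \<Rightarrow> real set" where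
  "alg_output D xs = result D (memory_after D xs)"

text \<open>A randomized algorithm is a probability distribution on deterministic ones. Its random bits are
  thus available during the whole pass without being charged as space, which includes algorithms
  tossing fresh coins in every step.\<close>

type_synonym rand_stream_alg = "stream_alg pmf"

definition uses_space :: "real set \<Rightarrow> nat \<Rightarrow> rand_stream_alg \<Rightarrow> nat \<Rightarrow> bool" where
  "uses_space U n A s \<longleftrightarrow>
     (\<forall>D \<in> set_pmf A. \<forall>I \<in> inputs U n. \<forall>xs \<in> permutations_of_set I. \<forall>k \<le> n.
        length (memory_after D (take k xs)) \<le> s)"

definition random_order_output :: "rand_stream_alg \<Rightarrow> real set \<Rightarrow> real set pmf" where
  "random_order_output A I =
     map_pmf (\<lambda>(xs, D). alg_output D xs) (pair_pmf (pmf_of_set (permutations_of_set I)) A)"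

definition expected_approx :: "real set \<Rightarrow> nat \<Rightarrow> rand_stream_alg \<Rightarrow> real \<Rightarrow> bool" where
  "expected_approx U n A \<beta> \<longleftrightarrow>
     (\<forall>I \<in> inputs U n.
        (\<forall>J \<in> set_pmf (random_order_output A I). J \<subseteq> I \<and> independent_intervals J) \<and>
        measure_pmf.expectation (random_order_output A I) (\<lambda>J. real (card J)) \<ge> \<beta> * real (opt I))"

definition approx_with_prob :: "real set \<Rightarrow> nat \<Rightarrow> rand_stream_alg \<Rightarrow> real \<Rightarrow> real \<Rightarrow> bool" where
  "approx_with_prob U n A \<beta> p \<longleftrightarrow>
     (\<forall>I \<in> inputs U n.
        measure_pmf.prob (random_order_output A I)
          {J. J \<subseteq> I \<and> independent_intervals J \<and> real (card J) \<ge> \<beta> * real (opt I)} \<ge> p)"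

end

theory Submission
  imports Defs
begin

text \<open>
  The hard instances consist of a clique of \<open>N = n - 2\<close> intervals, one per slot, each at one of \<open>K\<close>
  positions chosen independently and uniformly at random, together with an interval on either side
  of the clique. The gap between these two fits the interval of a random slot \<open>i\<close> and no other
  one, so the optimum is 3 and every independent set of size 3 contains the interval of slot \<open>i\<close>.
  With probability 1/3 that interval precedes both outer ones in the stream. In this case the
  memory content when the first outer interval arrives, together with the rest of the stream,
  determines for every slot read so far a guess of its position. With \<open>s\<close> bits there are fewer than
  \<open>2 ^ (s + 1)\<close> guess vectors, and by a Chernoff and union bound the best of them is correct in at
  most \<open>s + 1 + 2 N / K\<close> slots on average. Hence a set of size 3 is found with probability at most
  \<open>2/3 + (s + 1) / N + 2 / K\<close>, which falls below \<open>2/3 + \<epsilon>\<close> for large \<open>K\<close> unless \<open>s\<close> is linear in \<open>n\<close>.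
  An expected approximation factor \<open>8/9 + \<epsilon>\<close> forces success probability \<open>2/3 + 3 \<epsilon>\<close> on these
  instances, since every other output has size at most 2.
\<close>

section \<open>Relative order of a few elements in a uniformly random order\<close>

text \<open>Symmetry: for \<open>y\<close>, \<open>z\<close> in \<open>B\<close> the transposition
  of \<open>y\<close> and \<open>z\<close> preserves \<open>B\<close>, so it injects the orders
  whose first element of \<open>B\<close> is \<open>y\<close> into those where it is
  \<open>z\<close>. Hence all \<open>card B\<close> classes have equal size, and they partition the
  permutations.\<close>

lemma card_first_among:
  assumes S: "finite S" and B: "B \<subseteq> S" "x \<in> B"
  shows "card {\<sigma> \<in> permutations_of_set S. hd (filter (\<lambda>y. y \<in> B) \<sigma>) = x} * card B = fact (card S)"
proof -
  define C where "C y = {\<sigma> \<in> permutations_of_set S. hd (filter (\<lambda>y. y \<in> B) \<sigma>) = y}" for y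
  have finB: "finite B" using S B by (meson finite_subset)
  have hd_in: "hd (filter (\<lambda>y. y \<in> B) \<sigma>) \<in> B" if "\<sigma> \<in> permutations_of_set S" for \<sigma>
  proof -
    have "filter (\<lambda>y. y \<in> B) \<sigma> \<noteq> []"
      using that B by (auto simp: filter_empty_conv permutations_of_set_def)
    from hd_in_set[OF this] show ?thesis by simp
  qed
  have le: "card (C y) \<le> card (C z)" if yz: "y \<in> B" "z \<in> B" for y z
  proof (rule card_inj_on_le)
    let ?\<tau> = "Transposition.transpose y z"
    show "inj_on (map ?\<tau>) (C y)"
      by (metis inj_mapI inj_on_subset inj_transpose subset_UNIV)
    show "map ?\<tau> ` C y \<subseteq> C z"
    proof safe
      fix \<sigma> assume \<sigma>: "\<sigma> \<in> C y"
      have perm: "?\<tau> permutes S" using yz B by (intro permutes_swap_id) auto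
      have "map ?\<tau> \<sigma> \<in> permutations_of_set S"
        using permutations_of_set_image_permutes[OF perm] \<sigma> by (auto simp: C_def)
      moreover have "(\<lambda>w. w \<in> B) \<circ> ?\<tau> = (\<lambda>w. w \<in> B)"
        using yz by (auto simp: fun_eq_iff Transposition.transpose_def)
      then have "filter (\<lambda>w. w \<in> B) (map ?\<tau> \<sigma>) = map ?\<tau> (filter (\<lambda>w. w \<in> B) \<sigma>)"
        by (simp add: filter_map)
      moreover have "filter (\<lambda>w. w \<in> B) \<sigma> \<noteq> []"
        using \<sigma> B by (auto simp: filter_empty_conv permutations_of_set_def C_def)
      ultimately show "map ?\<tau> \<sigma> \<in> C z"
        using \<sigma> by (simp add: C_def hd_map)
    qed
    show "finite (C z)" by (simp add: C_def)
  qed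
  have "permutations_of_set S = (\<Union>y\<in>B. C y)" using hd_in by (auto simp: C_def)
  then have "fact (card S) = card (\<Union>y\<in>B. C y)" using S by (metis card_permutations_of_set)
  also have "\<dots> = (\<Sum>y\<in>B. card (C y))"
    by (rule card_UN_disjoint) (use finB in \<open>auto simp: C_def\<close>)
  also have "\<dots> = (\<Sum>y\<in>B. card (C x))"
    using le B by (intro sum.cong) (auto intro: antisym)
  finally show ?thesis by (simp add: C_def mult.commute)
qed

text \<open>The prefix stops at the first of the outer labels \<open>N\<close> and
  \<open>N + 1\<close>. If \<open>i\<close> comes first among \<open>i\<close>, \<open>N\<close> and
  \<open>N + 1\<close>, it lies in the prefix, and by symmetry this happens for exactly one third of
  the orders.\<close>

lemma card_not_in_prefix:
  assumes "i < N"
  shows "3 * card {\<sigma> \<in> permutations_of_set {..<N + 2}. i \<notin> set (takeWhile (\<lambda>j. j < N) \<sigma>)}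
    \<le> 2 * fact (N + 2)"
proof -
  let ?P = "permutations_of_set {..<N + 2}"
  let ?B = "{i, N, Suc N}"
  let ?H = "{\<sigma> \<in> ?P. hd (filter (\<lambda>y. y \<in> ?B) \<sigma>) = i}"
  have "card ?B = 3" using assms by auto
  then have H: "card ?H * 3 = fact (N + 2)"
    using card_first_among[of "{..<N + 2}" ?B i] assms by (simp del: fact_Suc)
  have "{\<sigma> \<in> ?P. i \<notin> set (takeWhile (\<lambda>j. j < N) \<sigma>)} \<subseteq> ?P - ?H"
  proof safe
    fix \<sigma> assume \<sigma>: "\<sigma> \<in> ?P" and i: "i \<notin> set (takeWhile (\<lambda>j. j < N) \<sigma>)"
      and h: "hd (filter (\<lambda>y. y \<in> ?B) \<sigma>) = i"
    let ?R = "dropWhile (\<lambda>j. j < N) \<sigma>"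
    have set: "set \<sigma> = {..<N + 2}" using \<sigma> by (simp add: permutations_of_set_def)
    then have "N \<in> set \<sigma>" by simp
    then have ne: "?R \<noteq> []" by auto
    have "\<not> hd ?R < N" using hd_dropWhile[OF ne] .
    moreover have "hd ?R \<in> set \<sigma>" using ne by (meson hd_in_set set_dropWhileD)
    then have "hd ?R < N + 2" unfolding set lessThan_iff .
    ultimately have hdR: "hd ?R = N \<or> hd ?R = Suc N" by linarith
    have "filter (\<lambda>y. y \<in> ?B) (takeWhile (\<lambda>j. j < N) \<sigma>) = []"
      using i by (auto simp: filter_empty_conv dest: set_takeWhileD)
    then have "filter (\<lambda>y. y \<in> ?B) \<sigma> = filter (\<lambda>y. y \<in> ?B) ?R"
      by (metis append_Nil filter_append takeWhile_dropWhile_id)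
    also have "\<dots> = hd ?R # filter (\<lambda>y. y \<in> ?B) (tl ?R)"
      by (subst list.collapse[OF ne, symmetric]) (use hdR in \<open>simp only: filter.simps, auto\<close>)
    finally show False using h hdR assms by auto
  qed
  then have "card {\<sigma> \<in> ?P. i \<notin> set (takeWhile (\<lambda>j. j < N) \<sigma>)} \<le> card (?P - ?H)"
    by (rule card_mono[rotated]) simp
  also have "\<dots> = fact (N + 2) - card ?H"
    by (subst card_Diff_subset) auto
  finally show ?thesis using H by simp
qed

section \<open>Splitting a run, and fixing the random choices before the order\<close>

lemma memory_after_append:
  "memory_after D (xs @ ys) =
     foldl (\<lambda>q (t, x). update D t x q) (memory_after D xs) (List.enumerate (length xs) ys)"
  by (simp add: memory_after_def enumerate_append_eq)

text \<open>Order and algorithm are independent, so the algorithm can be drawn first. The success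
  probability becomes an average of permutation counts for deterministic algorithms, as in the easy
  direction of Yao's principle.\<close>

lemma prob_random_order_output:
  assumes "finite I"
  shows "measure_pmf.prob (random_order_output A I) X =
    measure_pmf.expectation A
      (\<lambda>D. real (card {xs \<in> permutations_of_set I. alg_output D xs \<in> X}) / fact (card I))"
proof -
  let ?P = "pmf_of_set (permutations_of_set I)"
  have eq: "random_order_output A I = bind_pmf A (\<lambda>D. map_pmf (alg_output D) ?P)"
    unfolding random_order_output_def pair_pmf_def map_pmf_def
    by (subst (2) bind_commute_pmf) (simp add: bind_assoc_pmf bind_return_pmf)
  have "measure_pmf.prob (map_pmf (alg_output D) ?P) X =
      real (card {xs \<in> permutations_of_set I. alg_output D xs \<in> X}) / fact (card I)" for D
    using assms by (simp add: measure_pmf_of_set permutations_of_set_empty_iff Int_def vimage_def)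
  moreover have "measure_pmf.prob (bind_pmf A F) X =
      measure_pmf.expectation A (\<lambda>D. measure_pmf.prob (F D) X)" for F :: "stream_alg \<Rightarrow> real set pmf"
    unfolding measure_pmf_bind
    by (rule measure_pmf.measure_bind[where N = "count_space UNIV"])
      (auto intro: measure_pmf_in_subprob_space)
  ultimately show ?thesis by (simp add: eq)
qed

section \<open>Exponential moments and the union bound over memory contents\<close>

text \<open>Once \<open>f\<close> is fixed outside \<open>T\<close>, every guess \<open>g i\<close>
  with \<open>i\<close> in \<open>T\<close> is a constant while the values in \<open>T\<close> stay
  free. Each such coordinate matches for at most one of its \<open>K\<close> values, contributing at
  most \<open>K - 1 + exp 1\<close>, which is at most \<open>K + 2\<close>. The excess over
  \<open>K\<close> is absorbed by \<open>1 + 2 / K \<le> exp (2 / K)\<close>.\<close>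

lemma sum_exp_matches_le:
  fixes g :: "'a \<Rightarrow> ('a \<Rightarrow> nat) \<Rightarrow> nat"
  assumes S: "finite S" and T: "T \<subseteq> S" and K: "K > 0"
    and dep: "\<And>i f f'. i \<in> T \<Longrightarrow> (\<And>j. j \<in> S - T \<Longrightarrow> f j = f' j) \<Longrightarrow> g i f = g i f'"
  shows "(\<Sum>f \<in> S \<rightarrow>\<^sub>E {..<K}. exp (real (card {i \<in> T. g i f = f i})))
    \<le> real K ^ card S * exp (2 * real (card T) / real K)"
proof -
  define F where "F = S \<rightarrow>\<^sub>E {..<K}"
  define H where "H = (S - T) \<rightarrow>\<^sub>E {..<K}"
  have finT: "finite T" using S T by (rule finite_subset[rotated])
  have finF: "finite F" "finite H" using S by (auto simp: F_def H_def intro!: finite_PiE)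
  have fibre: "(\<Sum>f | f \<in> F \<and> restrict f (S - T) = h. exp (real (card {i \<in> T. g i f = f i})))
      \<le> (real K + 2) ^ card T" if h: "h \<in> H" for h
  proof -
    \<comment> \<open>The fibre over \<open>h\<close> is the product of the sets \<open>B i\<close>,
      and on it the exponential of the number of matches is the product of the weights
      \<open>w i\<close>, so the sum factors.\<close>
    define B where "B i = (if i \<in> T then {..<K} else {h i})" for i
    define w where "w i y = (if i \<in> T \<and> g i h = y then exp 1 else 1 :: real)" for i y
    have "{f. f \<in> F \<and> restrict f (S - T) = h} = PiE S B"
    proof (intro equalityI subsetI)
      fix f assume "f \<in> {f. f \<in> F \<and> restrict f (S - T) = h}"
      then have "f \<in> F" "\<And>i. i \<in> S - T \<Longrightarrow> f i = h i" by auto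
      then show "f \<in> PiE S B" by (auto simp: F_def B_def PiE_iff)
    next
      fix f assume f: "f \<in> PiE S B"
      then have "f i = h i" if "i \<in> S - T" for i using that by (auto simp: B_def PiE_iff split: if_splits)
      then have "restrict f (S - T) = h"
        using h by (auto simp: H_def PiE_iff extensional_def restrict_def fun_eq_iff)
      moreover have "f \<in> F" using f h T
        by (auto simp: F_def H_def B_def PiE_iff split: if_splits)
      ultimately show "f \<in> {f. f \<in> F \<and> restrict f (S - T) = h}" by simp
    qed
    moreover have "exp (real (card {i \<in> T. g i f = f i})) = (\<Prod>i\<in>S. w i (f i))" if f: "f \<in> PiE S B" for f
    proof -
      have "g i f = g i h" if "i \<in> T" for i
        using that f by (intro dep) (auto simp: B_def PiE_iff split: if_splits)
      then have "{i \<in> T. g i f = f i} = {i \<in> S. i \<in> T \<and> g i h = f i}" using T by auto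
      then show ?thesis
        using S by (simp add: w_def prod.If_cases Int_def exp_of_nat_mult flip: exp_of_nat_mult[of _ 1])
    qed
    ultimately have "(\<Sum>f | f \<in> F \<and> restrict f (S - T) = h. exp (real (card {i \<in> T. g i f = f i})))
        = (\<Sum>f\<in>PiE S B. \<Prod>i\<in>S. w i (f i))" by (simp cong: sum.cong)
    also have "\<dots> = (\<Prod>i\<in>S. \<Sum>y\<in>B i. w i y)"
      using S by (subst prod_sum_PiE) (auto simp: B_def)
    also have "\<dots> \<le> (\<Prod>i\<in>S. if i \<in> T then real K + 2 else 1)"
    proof (intro prod_mono conjI)
      fix i assume "i \<in> S"
      show "0 \<le> (\<Sum>y\<in>B i. w i y)" by (intro sum_nonneg) (simp add: w_def)
      show "(\<Sum>y\<in>B i. w i y) \<le> (if i \<in> T then real K + 2 else 1)"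
      proof (cases "i \<in> T")
        case True
        have "(\<Sum>y<K. w i y) \<le> (\<Sum>y<K. 1 + (if y = g i h then 2 else 0))"
          using exp_le by (intro sum_mono) (auto simp: w_def)
        also have "\<dots> \<le> real K + 2" by (simp add: sum.distrib)
        finally show ?thesis using True by (simp add: B_def)
      qed (simp add: B_def w_def)
    qed
    also have "\<dots> = (real K + 2) ^ card T"
      using S T by (simp add: prod.If_cases Int_absorb1 Int_commute)
    finally show ?thesis .
  qed
  have "(\<Sum>f\<in>F. exp (real (card {i \<in> T. g i f = f i}))) =
      (\<Sum>h\<in>H. \<Sum>f | f \<in> F \<and> restrict f (S - T) = h. exp (real (card {i \<in> T. g i f = f i})))"
    by (rule sum.group[symmetric]) (use finF in \<open>auto simp: F_def H_def PiE_iff\<close>)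
  also have "\<dots> \<le> (\<Sum>h\<in>H. (real K + 2) ^ card T)" by (intro sum_mono fibre)
  also have "\<dots> = real K ^ card (S - T) * (real K + 2) ^ card T"
    using S by (simp add: H_def card_PiE)
  also have "(real K + 2) ^ card T = real K ^ card T * (1 + 2 / real K) ^ card T"
    using K by (simp add: distrib_left flip: power_mult_distrib)
  also have "\<dots> \<le> real K ^ card T * exp (2 / real K) ^ card T"
    by (intro mult_left_mono power_mono) auto
  finally have "(\<Sum>f\<in>F. exp (real (card {i \<in> T. g i f = f i})))
      \<le> real K ^ card (S - T) * (real K ^ card T * exp (2 / real K) ^ card T)"
    by (simp add: mult_left_mono)
  also have "\<dots> = real K ^ (card (S - T) + card T) * exp (2 / real K) ^ card T"
    by (simp add: power_add)
  also have "card (S - T) + card T = card S"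
    using S T finT by (simp add: card_Diff_subset card_mono)
  also have "exp (2 / real K) ^ card T = exp (2 * real (card T) / real K)"
    by (simp add: mult.commute flip: exp_of_nat_mult)
  finally show ?thesis by (simp add: F_def)
qed

text \<open>Union bound over the guess vectors \<open>g p\<close>, \<open>p \<in> Q\<close>: instead of Jensen's inequality we use
  \<open>x \<le> c - 1 + exp (x - c)\<close> with \<open>c\<close> equal to the claimed average.\<close>

lemma sum_matches_le:
  fixes g :: "'q \<Rightarrow> 'a \<Rightarrow> ('a \<Rightarrow> nat) \<Rightarrow> nat"
  assumes S: "finite S" and T: "T \<subseteq> S" and K: "K > 0"
    and dep: "\<And>q i f f'. i \<in> T \<Longrightarrow> (\<And>j. j \<in> S - T \<Longrightarrow> f j = f' j) \<Longrightarrow> g q i f = g q i f'"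
    and Q: "finite Q" "real (card Q) \<le> exp b"
    and q: "\<And>f. f \<in> S \<rightarrow>\<^sub>E {..<K} \<Longrightarrow> q f \<in> Q"
  shows "(\<Sum>f \<in> S \<rightarrow>\<^sub>E {..<K}. real (card {i \<in> T. g (q f) i f = f i}))
    \<le> real K ^ card S * (b + 2 * real (card T) / real K)"
proof -
  let ?F = "S \<rightarrow>\<^sub>E {..<K}"
  define c where "c = b + 2 * real (card T) / real K"
  define X where "X p f = real (card {i \<in> T. g p i f = f i})" for p f
  have F: "finite ?F" "real (card ?F) = real K ^ card S"
    using S by (auto intro!: finite_PiE simp: card_PiE)
  have "(\<Sum>f\<in>?F. X (q f) f) \<le> (\<Sum>f\<in>?F. (c - 1) + exp (- c) * (\<Sum>p\<in>Q. exp (X p f)))"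
  proof (rule sum_mono)
    fix f assume "f \<in> ?F"
    then have "exp (X (q f) f) \<le> (\<Sum>p\<in>Q. exp (X p f))"
      using Q q by (intro member_le_sum) auto
    then have "exp (- c) * exp (X (q f) f) \<le> exp (- c) * (\<Sum>p\<in>Q. exp (X p f))"
      by (intro mult_left_mono) auto
    moreover have "1 + (X (q f) f - c) \<le> exp (- c) * exp (X (q f) f)"
      using exp_ge_add_one_self[of "X (q f) f - c"] by (simp add: mult_exp_exp)
    ultimately show "X (q f) f \<le> (c - 1) + exp (- c) * (\<Sum>p\<in>Q. exp (X p f))" by linarith
  qed
  also have "\<dots> = real K ^ card S * (c - 1) + exp (- c) * (\<Sum>p\<in>Q. \<Sum>f\<in>?F. exp (X p f))"
    using F by (subst sum.swap) (simp add: sum.distrib flip: sum_distrib_left)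
  also have "(\<Sum>p\<in>Q. \<Sum>f\<in>?F. exp (X p f))
      \<le> (\<Sum>p\<in>Q. real K ^ card S * exp (2 * real (card T) / real K))"
    unfolding X_def by (intro sum_mono sum_exp_matches_le S T K dep)
  also have "\<dots> \<le> exp b * (real K ^ card S * exp (2 * real (card T) / real K))"
    using Q by (simp add: mult_right_mono)
  also have "\<dots> = real K ^ card S * exp c" by (simp add: c_def exp_add)
  finally have "(\<Sum>f\<in>?F. X (q f) f)
      \<le> real K ^ card S * (c - 1) + exp (- c) * (real K ^ card S * exp c)"
    by (simp add: mult_left_mono)
  also have "\<dots> = real K ^ card S * c" by (simp add: exp_minus field_simps)
  finally show ?thesis by (simp add: X_def c_def)
qed

text \<open>Supplies \<open>b = s + 1\<close> for the union bound; passing from base 2 to base e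
  costs only a constant factor in \<open>s\<close>.\<close>

lemma card_memory_contents_le: "real (card {q :: bool list. length q \<le> s}) \<le> exp (real s + 1)"
proof -
  have "card {q :: bool list. length q \<le> s} = (\<Sum>i\<le>s. 2 ^ i)"
    using card_lists_length_le[of "UNIV :: bool set" s] by simp
  also have "\<dots> = 2 ^ Suc s - 1" by (induction s) auto
  finally have "real (card {q :: bool list. length q \<le> s}) \<le> 2 ^ Suc s" by simp
  also have "\<dots> \<le> exp 1 ^ Suc s"
    using exp_ge_add_one_self[of 1] by (intro power_mono) auto
  also have "\<dots> = exp (real s + 1)" by (simp add: exp_add exp_of_nat_mult[of s 1, simplified] mult.commute)
  finally show ?thesis .
qed

section \<open>Geometry of the hard instances\<close>

lemma independent_intervals_iff:
  "independent_intervals J \<longleftrightarrow> (\<forall>a\<in>J. \<forall>b\<in>J. a \<noteq> b \<longrightarrow> 1 < \<bar>a - b\<bar>)"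
proof -
  have "unit_interval a \<inter> unit_interval b = {} \<longleftrightarrow> 1 < \<bar>a - b\<bar>" for a b
    unfolding unit_interval_def Int_atLeastAtMost by (auto simp: max_def min_def)
  then show ?thesis by (auto simp: independent_intervals_def disjoint_family_on_def)
qed

lemma card_le_opt:
  assumes "finite I" "J \<subseteq> I" "independent_intervals J"
  shows "card J \<le> opt I"
  unfolding opt_def using assms by (intro Max_ge) auto

text \<open>The clique has one interval for each slot \<open>j < N\<close>, at one of \<open>K\<close> positions given by \<open>f j\<close>.
  Labels \<open>N\<close> and \<open>N + 1\<close> stand for the two outer intervals, whose gap fits slot \<open>i\<close> only.\<close>

locale hard_family =
  fixes N m K :: nat
  assumes N_pos: "N > 0" and K_pos: "K > 0" and fits: "N * Suc K \<le> m"
begin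

text \<open>Coordinates are in units of \<open>1 / m\<close>. Slot \<open>j\<close> owns a block of
  length \<open>Suc K\<close> starting at \<open>m + j * Suc K\<close>; the \<open>Suc v\<close>
  leaves the block's first point empty, so that an interval of the slot does not touch a left outer
  interval ending there.\<close>

definition slot_pos :: "nat \<Rightarrow> nat \<Rightarrow> nat" where
  "slot_pos j v = m + j * Suc K + Suc v"

text \<open>The left outer interval ends where block \<open>i\<close> begins, and the right one
  starts one unit length after block \<open>i\<close> ends. Only these two depend on
  \<open>i\<close>, so the clique alone does not reveal the slot that matters.\<close>

definition pos :: "nat \<Rightarrow> (nat \<Rightarrow> nat) \<Rightarrow> nat \<Rightarrow> nat" where
  "pos i f j = (if j < N then slot_pos j (f j)
     else if j = N then i * Suc K else 2 * m + Suc i * Suc K)"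

definition pt :: "nat \<Rightarrow> (nat \<Rightarrow> nat) \<Rightarrow> nat \<Rightarrow> real" where
  "pt i f j = real (pos i f j) / real m"

definition inst :: "nat \<Rightarrow> (nat \<Rightarrow> nat) \<Rightarrow> real set" where
  "inst i f = pt i f ` {..<N + 2}"

definition F :: "(nat \<Rightarrow> nat) set" where
  "F = {..<N} \<rightarrow>\<^sub>E {..<K}"

definition good :: "real set \<Rightarrow> real set set" where
  "good I = {J. J \<subseteq> I \<and> independent_intervals J \<and> 3 \<le> card J}"

lemma m_pos: "m > 0"
  using N_pos fits by (cases N) auto

text \<open>Moves disjointness into subtraction-free arithmetic on \<open>nat\<close>. The
  inequalities are strict because closed intervals that touch already intersect.\<close>

lemma far_iff: "1 < \<bar>real x / real m - real y / real m\<bar> \<longleftrightarrow> x + m < y \<or> y + m < x"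
  using m_pos by (simp add: abs_if field_simps flip: of_nat_add)

lemma slot_pos_less:
  assumes "v < K" "j < k"
  shows "slot_pos j v < m + k * Suc K"
proof -
  have "slot_pos j v < m + Suc j * Suc K" using assms by (simp add: slot_pos_def)
  also have "\<dots> \<le> m + k * Suc K" using assms by (intro add_left_mono mult_le_mono1) simp
  finally show ?thesis .
qed

lemma slot_pos_bounds:
  assumes "v < K" "j < N"
  shows "m < slot_pos j v" "slot_pos j v < 2 * m"
  using slot_pos_less[OF assms] fits by (simp_all add: slot_pos_def)

lemma left_less: "i < N \<Longrightarrow> i * Suc K < m"
  using fits mult_le_mono1[of "Suc i" N "Suc K"] by simp

lemma F_D: "f \<in> F \<Longrightarrow> j < N \<Longrightarrow> f j < K"
  by (auto simp: F_def)

lemma F_card: "finite F" "card F = K ^ N"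
  by (auto simp: F_def card_PiE intro: finite_PiE)

context
  fixes i f assumes i: "i < N" and f: "f \<in> F"
begin

lemma inj_pos: "inj_on (pos i f) {..<N + 2}"
proof (rule linorder_inj_onI')
  fix j k assume jk: "j \<in> {..<N + 2}" "k \<in> {..<N + 2}" "j < k"
  show "pos i f j \<noteq> pos i f k"
  proof (cases "k < N")
    case True
    then have "slot_pos j (f j) < m + k * Suc K" using jk F_D[OF f] by (intro slot_pos_less) auto
    then show ?thesis using True jk by (simp add: pos_def slot_pos_def)
  next
    case False
    then have "k = N \<or> k = Suc N" "j < N \<or> j = N \<and> k = Suc N" using jk by auto
    then show ?thesis
      using slot_pos_bounds[of "f j" j] F_D[OF f, of j] left_less[OF i] m_pos
      by (auto simp: pos_def)
  qed
qed

lemma inj_pt: "inj_on (pt i f) {..<N + 2}"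
  using inj_pos m_pos by (auto simp: inj_on_def pt_def)

lemma inst_grid: "inst i f \<subseteq> grid m"
proof -
  have "Suc i * Suc K \<le> m" using fits mult_le_mono1[of "Suc i" N "Suc K"] i by linarith
  then have "pos i f j \<le> 4 * m" if "j < N + 2" for j
    using that slot_pos_bounds[of "f j" j] F_D[OF f, of j] left_less[OF i]
    unfolding pos_def by (auto simp del: mult_Suc mult_Suc_right)
  then show ?thesis by (auto simp: inst_def pt_def grid_def)
qed

lemma inst_finite: "finite (inst i f)" and inst_card: "card (inst i f) = N + 2"
  using inj_pt by (simp_all add: inst_def card_image)

text \<open>All slot positions lie strictly between \<open>m\<close> and \<open>2 * m\<close>, so at
  most one clique interval can be chosen and size 3 requires both outer ones. A slot
  \<open>j < i\<close> then meets the left outer interval and a slot \<open>j > i\<close> the right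
  one, leaving only slot \<open>i\<close>.\<close>

lemma independent_subset_inst:
  assumes J: "J \<subseteq> inst i f" "independent_intervals J"
  shows "card J \<le> 3" and "3 \<le> card J \<Longrightarrow> pt i f i \<in> J"
proof -
  define L where "L = {j \<in> {..<N + 2}. pt i f j \<in> J}"
  have J_eq: "J = pt i f ` L" using J by (auto simp: L_def inst_def)
  have inj: "inj_on (pt i f) L" using inj_pt by (rule inj_on_subset) (auto simp: L_def)
  have card: "card J = card L" using inj by (simp add: J_eq card_image)
  have far: "pos i f j + m < pos i f k \<or> pos i f k + m < pos i f j" if "j \<in> L" "k \<in> L" "j \<noteq> k" for j k
    using J(2) that inj unfolding independent_intervals_iff J_eq
    by (auto simp: far_iff[symmetric] pt_def[symmetric] inj_on_eq_iff)
  let ?C = "L \<inter> {..<N}"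
  have "j = k" if "j \<in> ?C" "k \<in> ?C" for j k
    using far[of j k] that slot_pos_bounds[of "f j" j] slot_pos_bounds[of "f k" k]
      F_D[OF f, of j] F_D[OF f, of k] by (auto simp: pos_def)
  then have C: "card ?C \<le> 1" by (simp add: card_le_Suc0_iff_eq)
  have L: "L = ?C \<union> (L \<inter> {N, Suc N})" by (auto simp: L_def)
  have cardL: "card L \<le> card ?C + card (L \<inter> {N, Suc N})"
    by (subst L) (rule card_Un_le)
  have two: "card (L \<inter> {N, Suc N}) \<le> 2"
    using card_mono[of "{N, Suc N}" "L \<inter> {N, Suc N}"] by simp
  show "card J \<le> 3" using C cardL two card by simp
  assume "3 \<le> card J"
  then have "card ?C \<noteq> 0" and "card (L \<inter> {N, Suc N}) = 2"
    using C cardL two card by linarith+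
  moreover have "card {N, Suc N} = 2" by simp
  ultimately obtain j where j: "j \<in> L" "j < N" and sub: "L \<inter> {N, Suc N} = {N, Suc N}"
    using card_subset_eq[of "{N, Suc N}" "L \<inter> {N, Suc N}"] by auto
  have NL: "N \<in> L" "Suc N \<in> L" using sub by auto
  have fj: "f j < K" using F_D[OF f] j by simp
  have "\<not> j < i"
  proof
    assume "j < i"
    with fj have "slot_pos j (f j) < m + i * Suc K" by (rule slot_pos_less)
    then show False
      using far[of j N] j NL slot_pos_bounds[OF fj j(2)] left_less[OF i] by (simp add: pos_def)
  qed
  moreover have "\<not> i < j"
  proof
    assume "i < j"
    then have "Suc i * Suc K \<le> j * Suc K" by (intro mult_le_mono1) simp
    then show False
      using far[of j "Suc N"] j NL slot_pos_bounds[OF fj j(2)] by (simp add: pos_def slot_pos_def)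
  qed
  ultimately have "j = i" by simp
  then show "pt i f i \<in> J" using j by (simp add: L_def)
qed

lemma opt_inst: "opt (inst i f) = 3"
proof -
  let ?L = "{N, i, Suc N}"
  have sub: "?L \<subseteq> {..<N + 2}" using i by auto
  have inj: "inj_on (pt i f) ?L" using inj_pt sub by (rule inj_on_subset)
  have fi: "f i < K" using F_D[OF f i] .
  have "slot_pos i (f i) < m + Suc i * Suc K" using fi by (intro slot_pos_less) auto
  then have "pos i f N + m < pos i f i" "pos i f i + m < pos i f (Suc N)"
    using i by (simp_all add: pos_def slot_pos_def)
  then have "independent_intervals (pt i f ` ?L)"
    unfolding independent_intervals_iff pt_def by (auto simp del: of_nat_add simp: far_iff)
  moreover have "pt i f ` ?L \<subseteq> inst i f" using sub by (auto simp: inst_def)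
  moreover have "card (pt i f ` ?L) = 3" using inj i by (subst card_image) auto
  ultimately have "3 \<le> opt (inst i f)" using card_le_opt[OF inst_finite] by metis
  moreover have "opt (inst i f) \<le> 3"
    unfolding opt_def
  proof (rule Max.boundedI)
    show "finite (card ` {J. J \<subseteq> inst i f \<and> independent_intervals J})"
      using inst_finite by simp
    have "independent_intervals {}" by (simp add: independent_intervals_iff)
    then show "card ` {J. J \<subseteq> inst i f \<and> independent_intervals J} \<noteq> {}" by blast
  qed (use independent_subset_inst(1) in auto)
  ultimately show ?thesis by simp
qed

text \<open>Two different positions of one slot give intersecting intervals. An independent output
  that contains the true interval of slot \<open>i\<close> therefore contains no other candidate for
  it, which makes decoding unambiguous.\<close>

lemma slot_determined:
  assumes "independent_intervals J" "pt i f i \<in> J" "real (slot_pos i v) / real m \<in> J" "v < K"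
  shows "v = f i"
proof (rule ccontr)
  assume "v \<noteq> f i"
  then have ne: "pt i f i \<noteq> real (slot_pos i v) / real m"
    using m_pos i by (simp add: pt_def pos_def slot_pos_def)
  then have "1 < \<bar>pt i f i - real (slot_pos i v) / real m\<bar>"
    using assms unfolding independent_intervals_iff by blast
  then show False
    using slot_pos_bounds[OF \<open>v < K\<close> i] slot_pos_bounds[OF F_D[OF f i] i] i
    unfolding pt_def far_iff by (simp add: pos_def)
qed

end

section \<open>From finding triples to guessing slot positions\<close>

text \<open>For a fixed order the memory after the prefix \<open>T\<close> depends on
  \<open>f\<close> but not on \<open>i\<close>, and the rest of the stream depends on
  \<open>f\<close> only outside \<open>T\<close>. So a single memory content yields a guess for
  every slot in \<open>T\<close> at once, one for each possible \<open>i\<close>, and every success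
  is a correct guess.\<close>

lemma prefix_success_le:
  assumes space: "\<And>i f xs k. i < N \<Longrightarrow> f \<in> F \<Longrightarrow> xs \<in> permutations_of_set (inst i f) \<Longrightarrow> k \<le> N + 2 \<Longrightarrow>
      length (memory_after D (take k xs)) \<le> s"
    and \<sigma>: "\<sigma> \<in> permutations_of_set {..<N + 2}"
  shows "(\<Sum>f\<in>F. real (card {i \<in> set (takeWhile (\<lambda>j. j < N) \<sigma>).
            alg_output D (map (pt i f) \<sigma>) \<in> good (inst i f)}))
    \<le> real K ^ N * (real s + 1 + 2 * real N / real K)"
proof -
  define T where "T = takeWhile (\<lambda>j. j < N) \<sigma>"
  define R where "R = dropWhile (\<lambda>j. j < N) \<sigma>"
  define q where "q f = memory_after D (map (\<lambda>j. real (slot_pos j (f j)) / real m) T)" for f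
  define out where "out p i f = result D (foldl (\<lambda>q (t, x). update D t x q) p
      (List.enumerate (length T) (map (pt i f) R)))" for p i f
  \<comment> \<open>If the output holds no candidate for slot \<open>i\<close>, the choice is
    arbitrary. This is harmless, since extra matches only enlarge the upper bound on the
    successes.\<close>
  define g where "g p i f = (SOME v. v < K \<and> real (slot_pos i v) / real m \<in> out p i f)" for p i f
  have \<sigma>_eq: "\<sigma> = T @ R" by (simp add: T_def R_def)
  have dist: "distinct \<sigma>" and set\<sigma>: "set \<sigma> = {..<N + 2}"
    using \<sigma> by (auto simp: permutations_of_set_def)
  have TN: "set T \<subseteq> {..<N}" by (auto simp: T_def dest: set_takeWhileD)
  have mapT: "map (pt i f) T = map (\<lambda>j. real (slot_pos j (f j)) / real m) T" for i f
    using TN by (auto simp: pt_def pos_def)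
  have out_eq: "alg_output D (map (pt i f) \<sigma>) = out (q f) i f" for i f
    by (simp add: \<sigma>_eq alg_output_def memory_after_append mapT q_def out_def)
  have dep: "g p i f = g p i f'" if "\<And>j. j \<in> {..<N} - set T \<Longrightarrow> f j = f' j" for p i f f'
  proof -
    have "map (pt i f) R = map (pt i f') R"
    proof (rule map_cong[OF refl])
      fix j assume "j \<in> set R"
      then have "j \<notin> set T" using dist by (auto simp: \<sigma>_eq)
      then show "pt i f j = pt i f' j" using that by (auto simp: pt_def pos_def)
    qed
    then show ?thesis by (simp only: g_def out_def)
  qed
  have qQ: "q f \<in> {q. length q \<le> s}" if f: "f \<in> F" for f
  proof -
    \<comment> \<open>The space bound speaks about actual inputs only. As the prefix is the same for
      all \<open>i\<close>, the instance with \<open>i = 0\<close> serves as witness.\<close>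
    have "map (pt 0 f) \<sigma> \<in> permutations_of_set (inst 0 f)"
      unfolding inst_def permutations_of_set_image_inj[OF inj_pt[OF N_pos f]] using \<sigma> by simp
    moreover have "length T \<le> N + 2"
      using dist set\<sigma> distinct_card[of \<sigma>] by (simp add: \<sigma>_eq)
    ultimately have "length (memory_after D (take (length T) (map (pt 0 f) \<sigma>))) \<le> s"
      using space N_pos f by blast
    then show ?thesis by (simp add: q_def \<sigma>_eq mapT)
  qed
  have "(\<Sum>f\<in>F. real (card {i \<in> set T. alg_output D (map (pt i f) \<sigma>) \<in> good (inst i f)}))
      \<le> (\<Sum>f\<in>F. real (card {i \<in> set T. g (q f) i f = f i}))"
  proof (intro sum_mono of_nat_mono card_mono)
    fix f assume f: "f \<in> F"
    show "{i \<in> set T. alg_output D (map (pt i f) \<sigma>) \<in> good (inst i f)} \<subseteq> {i \<in> set T. g (q f) i f = f i}"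
    proof safe
      fix i assume iT: "i \<in> set T" and gd: "alg_output D (map (pt i f) \<sigma>) \<in> good (inst i f)"
      have i: "i < N" using iT TN by auto
      let ?J = "out (q f) i f"
      have J: "independent_intervals ?J" "pt i f i \<in> ?J"
        using gd independent_subset_inst(2)[OF i f] by (auto simp: good_def out_eq)
      then have "\<exists>v. v < K \<and> real (slot_pos i v) / real m \<in> ?J"
        using i F_D[OF f i] by (auto simp: pt_def pos_def)
      from someI_ex[OF this] have "g (q f) i f < K" "real (slot_pos i (g (q f) i f)) / real m \<in> ?J"
        unfolding g_def by auto
      then show "g (q f) i f = f i" using slot_determined[OF i f J] by simp
    qed
  qed simp
  also have "\<dots> \<le> real K ^ card {..<N} * ((real s + 1) + 2 * real (card (set T)) / real K)"
    unfolding F_def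
  proof (rule sum_matches_le)
    show "finite {q :: bool list. length q \<le> s}"
      using finite_lists_length_le[of "UNIV :: bool set" s] by simp
    show "real (card {q :: bool list. length q \<le> s}) \<le> exp (real s + 1)"
      by (rule card_memory_contents_le)
    show "g p i f = g p i f'" if "\<And>j. j \<in> {..<N} - set T \<Longrightarrow> f j = f' j" for p i f f'
      using that by (rule dep)
  qed (use TN K_pos qQ in \<open>simp_all add: F_def\<close>)
  also have "\<dots> \<le> real K ^ N * (real s + 1 + 2 * real N / real K)"
  proof -
    have "card (set T) \<le> N" using card_mono[OF _ TN] by simp
    then have "2 * real (card (set T)) / real K \<le> 2 * real N / real K"
      by (intro divide_right_mono) auto
    then show ?thesis by (simp add: mult_left_mono)
  qed
  finally show ?thesis by (simp add: T_def)
qed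

text \<open>Orders in which slot \<open>i\<close> misses the prefix are all counted as successes, at
  most two thirds of them. For the others the sums are exchanged so that the order is fixed
  outermost and the bound for a fixed order applies to all \<open>i\<close> and \<open>f\<close>
  together.\<close>

lemma total_success_le:
  assumes space: "\<And>i f xs k. i < N \<Longrightarrow> f \<in> F \<Longrightarrow> xs \<in> permutations_of_set (inst i f) \<Longrightarrow> k \<le> N + 2 \<Longrightarrow>
      length (memory_after D (take k xs)) \<le> s"
  shows "(\<Sum>i<N. \<Sum>f\<in>F.
        real (card {xs \<in> permutations_of_set (inst i f). alg_output D xs \<in> good (inst i f)}))
    \<le> fact (N + 2) * real K ^ N * (2 / 3 * real N + (real s + 1 + 2 * real N / real K))"
proof -
  let ?P = "permutations_of_set {..<N + 2}"
  define E where "E i \<sigma> \<longleftrightarrow> i \<in> set (takeWhile (\<lambda>j. j < N) \<sigma>)" for i \<sigma>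
  define G where "G i f \<sigma> \<longleftrightarrow> alg_output D (map (pt i f) \<sigma>) \<in> good (inst i f)" for i f \<sigma>
  have count: "real (card {x \<in> A. P x}) = (\<Sum>x\<in>A. of_bool (P x))" if "finite A" for A :: "'c set" and P
    using that by (simp add: Int_def)
  have split: "real (card {xs \<in> permutations_of_set (inst i f). alg_output D xs \<in> good (inst i f)})
      \<le> 2 / 3 * fact (N + 2) + (\<Sum>\<sigma>\<in>?P. of_bool (E i \<sigma> \<and> G i f \<sigma>))"
    if i: "i < N" and f: "f \<in> F" for i f
  proof -
    \<comment> \<open>Orders of the instance are relabelled as orders of the labels, so that
      different \<open>i\<close> and \<open>f\<close> share the same permutation.\<close>
    have "{xs \<in> permutations_of_set (inst i f). alg_output D xs \<in> good (inst i f)} =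
        map (pt i f) ` {\<sigma> \<in> ?P. G i f \<sigma>}"
      unfolding inst_def permutations_of_set_image_inj[OF inj_pt[OF i f]] by (auto simp: G_def inst_def)
    then have "card {xs \<in> permutations_of_set (inst i f). alg_output D xs \<in> good (inst i f)}
        \<le> card {\<sigma> \<in> ?P. G i f \<sigma>}" by (simp add: card_image_le)
    also have "\<dots> \<le> card ({\<sigma> \<in> ?P. \<not> E i \<sigma>} \<union> {\<sigma> \<in> ?P. E i \<sigma> \<and> G i f \<sigma>})"
      by (rule card_mono) auto
    also have "\<dots> \<le> card {\<sigma> \<in> ?P. \<not> E i \<sigma>} + card {\<sigma> \<in> ?P. E i \<sigma> \<and> G i f \<sigma>}"
      by (rule card_Un_le)
    finally have "real (card {xs \<in> permutations_of_set (inst i f). alg_output D xs \<in> good (inst i f)})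
        \<le> real (card {\<sigma> \<in> ?P. \<not> E i \<sigma>}) + real (card {\<sigma> \<in> ?P. E i \<sigma> \<and> G i f \<sigma>})" by linarith
    moreover have "real (3 * card {\<sigma> \<in> ?P. \<not> E i \<sigma>}) \<le> real (2 * fact (N + 2))"
      unfolding E_def of_nat_le_iff by (rule card_not_in_prefix[OF i])
    then have "3 * real (card {\<sigma> \<in> ?P. \<not> E i \<sigma>}) \<le> 2 * fact (N + 2)"
      by (simp del: fact_Suc)
    moreover have "real (card {\<sigma> \<in> ?P. E i \<sigma> \<and> G i f \<sigma>}) = (\<Sum>\<sigma>\<in>?P. of_bool (E i \<sigma> \<and> G i f \<sigma>))"
      by (rule count) simp
    ultimately show ?thesis by linarith
  qed
  have "(\<Sum>i<N. \<Sum>f\<in>F. \<Sum>\<sigma>\<in>?P. of_bool (E i \<sigma> \<and> G i f \<sigma>) :: real)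
      = (\<Sum>f\<in>F. \<Sum>i<N. \<Sum>\<sigma>\<in>?P. of_bool (E i \<sigma> \<and> G i f \<sigma>))" by (rule sum.swap)
  also have "\<dots> = (\<Sum>f\<in>F. \<Sum>\<sigma>\<in>?P. \<Sum>i<N. of_bool (E i \<sigma> \<and> G i f \<sigma>))"
    by (intro sum.cong refl sum.swap)
  also have "\<dots> = (\<Sum>\<sigma>\<in>?P. \<Sum>f\<in>F. \<Sum>i<N. of_bool (E i \<sigma> \<and> G i f \<sigma>))" by (rule sum.swap)
  also have "\<dots> = (\<Sum>\<sigma>\<in>?P. \<Sum>f\<in>F. real (card {i \<in> {..<N}. E i \<sigma> \<and> G i f \<sigma>}))"
    by (intro sum.cong refl count[symmetric]) simp
  also have "\<dots> \<le> (\<Sum>\<sigma>\<in>?P. real K ^ N * (real s + 1 + 2 * real N / real K))"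
  proof (rule sum_mono)
    fix \<sigma> assume \<sigma>: "\<sigma> \<in> ?P"
    have "{i \<in> {..<N}. E i \<sigma> \<and> G i f \<sigma>} =
        {i \<in> set (takeWhile (\<lambda>j. j < N) \<sigma>). alg_output D (map (pt i f) \<sigma>) \<in> good (inst i f)}" for f
      by (auto simp: E_def G_def dest: set_takeWhileD)
    then show "(\<Sum>f\<in>F. real (card {i \<in> {..<N}. E i \<sigma> \<and> G i f \<sigma>}))
        \<le> real K ^ N * (real s + 1 + 2 * real N / real K)"
      using prefix_success_le[OF space \<sigma>] by simp
  qed
  also have "\<dots> = fact (N + 2) * (real K ^ N * (real s + 1 + 2 * real N / real K))"
    by (simp del: fact_Suc)
  finally have main: "(\<Sum>i<N. \<Sum>f\<in>F. \<Sum>\<sigma>\<in>?P. of_bool (E i \<sigma> \<and> G i f \<sigma>) :: real)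
      \<le> fact (N + 2) * (real K ^ N * (real s + 1 + 2 * real N / real K))" .
  have "(\<Sum>i<N. \<Sum>f\<in>F.
        real (card {xs \<in> permutations_of_set (inst i f). alg_output D xs \<in> good (inst i f)}))
      \<le> (\<Sum>i<N. \<Sum>f\<in>F. 2 / 3 * fact (N + 2) + (\<Sum>\<sigma>\<in>?P. of_bool (E i \<sigma> \<and> G i f \<sigma>)))"
    by (intro sum_mono split) auto
  also have "\<dots> = real N * (real K ^ N * (2 / 3 * fact (N + 2)))
      + (\<Sum>i<N. \<Sum>f\<in>F. \<Sum>\<sigma>\<in>?P. of_bool (E i \<sigma> \<and> G i f \<sigma>))"
    by (simp add: sum.distrib F_card del: fact_Suc)
  also have "\<dots> \<le> real N * (real K ^ N * (2 / 3 * fact (N + 2)))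
      + fact (N + 2) * (real K ^ N * (real s + 1 + 2 * real N / real K))"
    using main by simp
  finally show ?thesis by (simp add: algebra_simps del: fact_Suc)
qed

text \<open>Averaging over \<open>i\<close> and \<open>f\<close>: the guarantee \<open>p\<close>
  holds for every instance, while the total success of each deterministic algorithm in the support
  of \<open>A\<close> is bounded. Exchanging the finite sums with the expectation over
  \<open>A\<close> compares the two.\<close>

lemma space_lower_bound:
  assumes U: "grid m \<subseteq> U" and space: "uses_space U (N + 2) A s"
    and prob: "\<And>i f. i < N \<Longrightarrow> f \<in> F \<Longrightarrow>
      p \<le> measure_pmf.prob (random_order_output A (inst i f)) (good (inst i f))"
  shows "p * real N \<le> 2 / 3 * real N + (real s + 1 + 2 * real N / real K)"
proof -
  define c where "c = 2 / 3 * real N + (real s + 1 + 2 * real N / real K)"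
  define Z where "Z D i f =
    real (card {xs \<in> permutations_of_set (inst i f). alg_output D xs \<in> good (inst i f)}) / fact (N + 2)"
    for D i f
  have Z: "measure_pmf.prob (random_order_output A (inst i f)) (good (inst i f)) =
      measure_pmf.expectation A (\<lambda>D. Z D i f)" if "i < N" "f \<in> F" for i f
    using prob_random_order_output[OF inst_finite[OF that]] inst_card[OF that] by (simp add: Z_def)
  have Z_le: "0 \<le> Z D i f \<and> Z D i f \<le> 1" if "i < N" "f \<in> F" for D i f
  proof -
    have "card {xs \<in> permutations_of_set (inst i f). alg_output D xs \<in> good (inst i f)}
        \<le> card (permutations_of_set (inst i f))" by (rule card_mono) auto
    also have "\<dots> = fact (N + 2)"
      using inst_finite[OF that] inst_card[OF that] by simp
    finally have "real (card {xs \<in> permutations_of_set (inst i f). alg_output D xs \<in> good (inst i f)})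
        \<le> real (fact (N + 2))" by (rule of_nat_mono)
    then show ?thesis by (simp add: Z_def del: fact_Suc)
  qed
  \<comment> \<open>The support of \<open>A\<close> may be infinite, so integrability has to come
    from boundedness.\<close>
  have int: "integrable A (\<lambda>D. Z D i f)" if "i < N" "f \<in> F" for i f
    using Z_le[OF that] by (intro measure_pmf.integrable_const_bound[where B = 1]) auto
  have Z_sum: "(\<Sum>i<N. \<Sum>f\<in>F. Z D i f) \<le> real K ^ N * c" if D: "D \<in> set_pmf A" for D
  proof -
    have "length (memory_after D (take k xs)) \<le> s"
      if "i < N" "f \<in> F" "xs \<in> permutations_of_set (inst i f)" "k \<le> N + 2" for i f xs k
    proof -
      have "inst i f \<in> inputs U (N + 2)"
        using inst_finite[OF that(1,2)] inst_card[OF that(1,2)] inst_grid[OF that(1,2)] U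
        by (auto simp: inputs_def)
      then show ?thesis using space D that unfolding uses_space_def by blast
    qed
    from total_success_le[OF this] show ?thesis
      unfolding Z_def sum_divide_distrib[symmetric] c_def[symmetric]
      by (simp add: divide_le_eq mult_ac del: fact_Suc)
  qed
  have "real K ^ N * (p * real N) = (\<Sum>i<N. \<Sum>f\<in>F. p)"
    by (simp add: F_card)
  also have "\<dots> \<le> (\<Sum>i<N. \<Sum>f\<in>F. measure_pmf.expectation A (\<lambda>D. Z D i f))"
    using prob Z by (intro sum_mono) auto
  also have "\<dots> = measure_pmf.expectation A (\<lambda>D. \<Sum>i<N. \<Sum>f\<in>F. Z D i f)"
    using int by (simp add: Bochner_Integration.integral_sum Bochner_Integration.integrable_sum)
  also have "\<dots> \<le> real K ^ N * c"
    using int Z_sum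
    by (intro measure_pmf.integral_le_const Bochner_Integration.integrable_sum) (auto intro: AE_pmfI)
  finally show ?thesis using K_pos by (simp add: c_def)
qed

end

section \<open>Choice of parameters and the two lower bounds\<close>

lemma linear_space_if_finds_triples:
  fixes U :: "nat \<Rightarrow> real set" and m :: "nat \<Rightarrow> nat" and A :: "nat \<Rightarrow> rand_stream_alg"
    and s :: "nat \<Rightarrow> nat"
  assumes eps: "\<epsilon> > 0"
    and grid: "\<And>n. n ^ 2 \<le> m n \<and> grid (m n) \<subseteq> U n"
    and space: "\<And>n. uses_space (U n) n (A n) (s n)"
    and prob: "\<And>n I. I \<in> inputs (U n) n \<Longrightarrow> opt I = 3 \<Longrightarrow>
      2 / 3 + \<epsilon> \<le> measure_pmf.prob (random_order_output (A n) I)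
        {J. J \<subseteq> I \<and> independent_intervals J \<and> 3 \<le> card J}"
  shows "(\<lambda>n. real (s n)) \<in> \<Omega>(\<lambda>n. real n)"
proof -
  \<comment> \<open>A constant \<open>K\<close> of this size brings the error
    \<open>2 * N / K\<close> down to at most \<open>\<epsilon> * N / 2\<close>, half of the
    advantage.\<close>
  obtain K :: nat where K: "4 / \<epsilon> < real K" using reals_Archimedean2 by blast
  have K_pos: "K > 0" using K eps by (cases K) (auto simp: divide_less_0_iff)
  \<comment> \<open>Chosen so that \<open>\<epsilon> * (n - 2) / 2 - 1\<close> is at least
    \<open>\<epsilon> * n / 4\<close>.\<close>
  obtain n1 :: nat where n1: "4 * (\<epsilon> + 1) / \<epsilon> < real n1" using reals_Archimedean2 by blast
  have "\<epsilon> / 4 * real n \<le> real (s n)" if n: "n \<ge> max n1 (K + 3)" for n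
  proof -
    define N where "N = n - 2"
    have n_eq: "n = N + 2" using n unfolding N_def by linarith
    \<comment> \<open>Here \<open>n \<ge> K + 3\<close> gives \<open>Suc K \<le> n\<close>, so a
      grid of quadratic resolution has room for all blocks.\<close>
    have "N * Suc K \<le> n * n" using n by (intro mult_le_mono) (auto simp: N_def)
    also have "\<dots> \<le> m n" using grid[of n] by (simp add: power2_eq_square)
    finally have "N * Suc K \<le> m n" .
    moreover have "N > 0" using n by (simp add: N_def)
    ultimately interpret hard_family N "m n" K
      using K_pos by unfold_locales
    have "(2 / 3 + \<epsilon>) * real N \<le> 2 / 3 * real N + (real (s n) + 1 + 2 * real N / real K)"
    proof (rule space_lower_bound)
      fix i f assume if_: "i < N" "f \<in> F"
      have "inst i f \<in> inputs (U n) n"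
        using inst_finite[OF if_] inst_card[OF if_] inst_grid[OF if_] grid[of n]
        by (auto simp: inputs_def n_eq)
      from prob[OF this opt_inst[OF if_]]
      show "2 / 3 + \<epsilon> \<le> measure_pmf.prob (random_order_output (A n) (inst i f)) (good (inst i f))"
        by (simp add: good_def)
    qed (use grid[of n] space[of n] in \<open>auto simp: n_eq\<close>)
    moreover have "2 / real K * real N \<le> \<epsilon> / 2 * real N"
      using K K_pos eps by (intro mult_right_mono) (auto simp: field_simps)
    ultimately have "\<epsilon> * real N / 2 \<le> real (s n) + 1"
      unfolding distrib_right times_divide_eq_left by linarith
    moreover have "4 * (\<epsilon> + 1) \<le> \<epsilon> * real n"
    proof -
      have "4 * (\<epsilon> + 1) / \<epsilon> \<le> real n" using n1 n by linarith
      then show ?thesis using eps by (simp add: divide_le_eq mult.commute)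
    qed
    ultimately show ?thesis by (simp add: n_eq algebra_simps)
  qed
  then have "eventually (\<lambda>n. \<epsilon> / 4 * norm (real n) \<le> norm (real (s n))) at_top"
    unfolding eventually_at_top_linorder by (intro exI[of _ "max n1 (K + 3)"]) simp
  then show ?thesis using eps unfolding bigomega_def
    by (intro CollectI exI[of _ "\<epsilon> / 4"]) auto
qed

text \<open>Outputs have size at most 3, and at most 2 outside the event, so the size is bounded by
  2 plus the indicator of the event.\<close>

lemma prob_triple_ge_expectation:
  assumes I: "finite I" "opt I = 3"
    and sup: "\<And>J. J \<in> set_pmf M \<Longrightarrow> J \<subseteq> I \<and> independent_intervals J"
  shows "measure_pmf.expectation M (\<lambda>J. real (card J)) - 2
    \<le> measure_pmf.prob M {J. J \<subseteq> I \<and> independent_intervals J \<and> 3 \<le> card J}"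
proof -
  let ?G = "{J. J \<subseteq> I \<and> independent_intervals J \<and> 3 \<le> card J}"
  have le: "real (card J) \<le> 2 + indicator ?G J" if "J \<in> set_pmf M" for J
    using sup[OF that] card_le_opt[OF I(1), of J] I(2) by (auto simp: indicator_def)
  have ind: "integrable M (indicat_real ?G)"
    by (intro measure_pmf.integrable_const_bound[where B = 1]) auto
  have "measure_pmf.expectation M (\<lambda>J. real (card J)) \<le>
      measure_pmf.expectation M (\<lambda>J. 2 + indicator ?G J)"
  proof (intro integral_mono_AE AE_pmfI le)
    have "real (card J) \<le> 3" if "J \<in> set_pmf M" for J
      using sup[OF that] card_le_opt[OF I(1), of J] I(2) by simp
    then show "integrable M (\<lambda>J. real (card J))"
      by (intro measure_pmf.integrable_const_bound[where B = 3] AE_pmfI) auto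
  qed (use ind in \<open>auto intro!: Bochner_Integration.integrable_add\<close>)
  also have "\<dots> = 2 + measure_pmf.prob M ?G"
    using ind by (subst Bochner_Integration.integral_add) auto
  finally show ?thesis by simp
qed

theorem theorem2:
  fixes \<epsilon> :: real
  assumes "\<epsilon> > 0"
  shows "(\<forall>(U :: nat \<Rightarrow> real set) (m :: nat \<Rightarrow> nat) (A :: nat \<Rightarrow> rand_stream_alg) (s :: nat \<Rightarrow> nat).
            (\<forall>n. n ^ 2 \<le> m n \<and> grid (m n) \<subseteq> U n) \<longrightarrow>
            (\<forall>n. uses_space (U n) n (A n) (s n)) \<longrightarrow>
            (\<forall>n. expected_approx (U n) n (A n) (8 / 9 + \<epsilon>)) \<longrightarrow>
            (\<lambda>n. real (s n)) \<in> \<Omega>(\<lambda>n. real n))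
       \<and> (\<forall>\<delta> > 0. \<forall>(U :: nat \<Rightarrow> real set) (m :: nat \<Rightarrow> nat) (A :: nat \<Rightarrow> rand_stream_alg) (s :: nat \<Rightarrow> nat).
            (\<forall>n. n ^ 2 \<le> m n \<and> grid (m n) \<subseteq> U n) \<longrightarrow>
            (\<forall>n. uses_space (U n) n (A n) (s n)) \<longrightarrow>
            (\<forall>n. approx_with_prob (U n) n (A n) (2 / 3 + \<delta>) (2 / 3 + \<epsilon>)) \<longrightarrow>
            (\<lambda>n. real (s n)) \<in> \<Omega>(\<lambda>n. real n))"
proof (intro conjI allI impI)
  fix U :: "nat \<Rightarrow> real set" and m :: "nat \<Rightarrow> nat" and A :: "nat \<Rightarrow> rand_stream_alg" and s :: "nat \<Rightarrow> nat"
  assume "\<forall>n. n ^ 2 \<le> m n \<and> grid (m n) \<subseteq> U n" "\<forall>n. uses_space (U n) n (A n) (s n)"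
    and approx: "\<forall>n. expected_approx (U n) n (A n) (8 / 9 + \<epsilon>)"
  then show "(\<lambda>n. real (s n)) \<in> \<Omega>(\<lambda>n. real n)"
  proof (intro linear_space_if_finds_triples[OF assms, of m U A])
    fix n I assume I: "I \<in> inputs (U n) n" "opt I = 3"
    let ?M = "random_order_output (A n) I"
    from I approx have sup: "\<And>J. J \<in> set_pmf ?M \<Longrightarrow> J \<subseteq> I \<and> independent_intervals J"
      and ex: "(8 / 9 + \<epsilon>) * 3 \<le> measure_pmf.expectation ?M (\<lambda>J. real (card J))"
      unfolding expected_approx_def by force+
    have "finite I" using I by (simp add: inputs_def)
    then have "measure_pmf.expectation ?M (\<lambda>J. real (card J)) - 2
        \<le> measure_pmf.prob ?M {J. J \<subseteq> I \<and> independent_intervals J \<and> 3 \<le> card J}"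
      using I(2) sup by (rule prob_triple_ge_expectation)
    \<comment> \<open>The numbers:
      \<open>3 * (8 / 9 + \<epsilon>) - 2 = 2 / 3 + 3 * \<epsilon>\<close>.\<close>
    then show "2 / 3 + \<epsilon> \<le> measure_pmf.prob ?M {J. J \<subseteq> I \<and> independent_intervals J \<and> 3 \<le> card J}"
      using ex assms by simp
  qed auto
next
  fix \<delta> :: real and U :: "nat \<Rightarrow> real set" and m :: "nat \<Rightarrow> nat" and A :: "nat \<Rightarrow> rand_stream_alg"
    and s :: "nat \<Rightarrow> nat"
  assume \<delta>: "\<delta> > 0"
  assume "\<forall>n. n ^ 2 \<le> m n \<and> grid (m n) \<subseteq> U n" "\<forall>n. uses_space (U n) n (A n) (s n)"
    and approx: "\<forall>n. approx_with_prob (U n) n (A n) (2 / 3 + \<delta>) (2 / 3 + \<epsilon>)"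
  then show "(\<lambda>n. real (s n)) \<in> \<Omega>(\<lambda>n. real n)"
  proof (intro linear_space_if_finds_triples[OF assms, of m U A])
    fix n I assume I: "I \<in> inputs (U n) n" "opt I = 3"
    let ?M = "random_order_output (A n) I"
    from I approx have "2 / 3 + \<epsilon> \<le> measure_pmf.prob ?M
        {J. J \<subseteq> I \<and> independent_intervals J \<and> (2 / 3 + \<delta>) * real (opt I) \<le> real (card J)}"
      unfolding approx_with_prob_def by blast
    \<comment> \<open>With optimum 3 the required size is \<open>2 + 3 * \<delta>\<close>, and an
      integer above 2 is at least 3.\<close>
    also have "\<dots> \<le> measure_pmf.prob ?M {J. J \<subseteq> I \<and> independent_intervals J \<and> 3 \<le> card J}"
      using \<delta> I(2) by (intro measure_pmf.finite_measure_mono) (auto simp: algebra_simps)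
    finally show "2 / 3 + \<epsilon> \<le> measure_pmf.prob ?M {J. J \<subseteq> I \<and> independent_intervals J \<and> 3 \<le> card J}" .
  qed auto
qed

end
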